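(* If $F$ is a friend of $10$, then $$F>625\cdot 9^{\omega(F)-3}.$$
   Context: For a positive integer $n$, $\sigma(n)$ denotes the sum of the positive divisors of $n$, $I(n)=\sigma(n)/n$ is the abundancy index of $n$, and $\omega(n)$ is the number of distinct prime divisors of $n$. Two distinct positive integers are friends of each other if they have the same abundancy index. Thus a friend of $10$ is a positive integer $F\neq 10$ with $I(F)=I(10)=9/5$, i.e. $5\sigma(F)=9F$. *)

theory Defs
  imports Complex_Main "HOL-Computational_Algebra.Primes"
begin

definition divisor_sum :: "nat \<Rightarrow> nat" where
  "divisor_sum n = \<Sum>{d. d dvd n}"

definition abundancy_index :: "nat \<Rightarrow> real" where
  "abundancy_index n = real (divisor_sum n) / real n"

definition omega :: "nat \<Rightarrow> nat" where
  "omega n = card (prime_factors n)"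

definition friends :: "nat \<Rightarrow> nat \<Rightarrow> bool" where
  "friends m n \<longleftrightarrow> m > 0 \<and> n > 0 \<and> m \<noteq> n \<and> abundancy_index m = abundancy_index n"

end

theory Submission
  imports Defs
begin

text \<open>
  From \<open>5 \<sigma>(F) = 9 F\<close> one gets \<open>5 dvd F\<close>. If \<open>F\<close> were even it would be a proper multiple of \<open>10\<close>,
  and its abundancy index would exceed that of \<open>10\<close>; so \<open>F\<close> is odd, and hence so is \<open>\<sigma>(F)\<close>.
  A prime \<open>p\<close> dividing \<open>F\<close> exactly once would contribute the even factor \<open>1 + p\<close> to \<open>\<sigma>(F)\<close>, so the
  square of every prime divisor divides \<open>F\<close>. One of these squares is \<open>25\<close> and the others are at
  least \<open>9\<close>, so \<open>F \<ge> 25 * 9 ^ (\<omega>(F) - 1)\<close>, and \<open>25 > 625 / 81\<close>.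
\<close>

text \<open>A divisor of \<open>p * m\<close> is either coprime to \<open>p\<close>, hence a divisor
  of \<open>m\<close>, or \<open>p\<close> times a divisor of \<open>m\<close>; the two kinds do not
  overlap because \<open>p\<close> does not divide \<open>m\<close>.\<close>

lemma divisor_sum_prime_mult:
  assumes "prime p" "\<not> p dvd m" "m > 0"
  shows "divisor_sum (p * m) = (1 + p) * divisor_sum m"
proof -
  let ?D = "{d. d dvd m}"
  have "{d. d dvd p * m} = ?D \<union> (*) p ` ?D"
  proof (intro equalityI subsetI)
    fix d assume d: "d \<in> {d. d dvd p * m}"
    show "d \<in> ?D \<union> (*) p ` ?D"
    proof (cases "p dvd d")
      case True
      with d assms show ?thesis by (auto elim!: dvdE)
    next
      case False
      hence "coprime d p" using assms(1) by (metis prime_imp_coprime coprime_commute)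
      with d show ?thesis by (simp add: coprime_dvd_mult_right_iff)
    qed
  qed auto
  moreover have "?D \<inter> (*) p ` ?D = {}"
    using assms by (auto dest: dvd_mult_left)
  moreover have "inj_on ((*) p) ?D"
    using assms by (auto simp: inj_on_def)
  ultimately show ?thesis
    using assms
    by (simp add: divisor_sum_def sum.union_disjoint sum.reindex sum.distrib sum_distrib_left)
qed

lemma divisor_sum_10: "divisor_sum 10 = 18"
  using divisor_sum_prime_mult[of 2 5] divisor_sum_prime_mult[of 5 1]
  by (simp add: divisor_sum_def)

text \<open>Clearing denominators gives an equation over the naturals, from which divisibility and
  parity can be read off.\<close>

lemma friends_10_iff: "friends F 10 \<longleftrightarrow> F > 0 \<and> F \<noteq> 10 \<and> 5 * divisor_sum F = 9 * F"
proof -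
  have "abundancy_index F = abundancy_index 10 \<longleftrightarrow> 5 * divisor_sum F = 9 * F" if "F > 0"
  proof -
    have "abundancy_index F = abundancy_index 10 \<longleftrightarrow> real (5 * divisor_sum F) = real (9 * F)"
      using that by (auto simp: abundancy_index_def divisor_sum_10 field_simps)
    thus ?thesis by (simp only: of_nat_eq_iff)
  qed
  thus ?thesis by (auto simp: friends_def)
qed

lemma divisor_sum_multiple_10:
  assumes "m > 1"
  shows "divisor_sum (10 * m) > 18 * m"
proof -
  \<comment> \<open>For \<open>m > 1\<close> these five divisors of \<open>10 * m\<close> are
    distinct; the divisor \<open>1\<close> makes the bound strict.\<close>
  have "1 + 18 * m = \<Sum>{1, m, 2 * m, 5 * m, 10 * m}"
    using assms by simp
  also have "\<dots> \<le> divisor_sum (10 * m)"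
    unfolding divisor_sum_def
    by (rule sum_mono2) (use assms in \<open>auto intro!: mult_dvd_mono\<close>)
  finally show ?thesis by simp
qed

lemma square_dvd_of_odd_divisor_sum:
  assumes "odd n" "odd (divisor_sum n)" "prime p" "p dvd n"
  shows "p ^ 2 dvd n"
proof (rule ccontr)
  assume not: "\<not> p ^ 2 dvd n"
  obtain m where n: "n = p * m" using assms by (auto elim: dvdE)
  have "\<not> p dvd m" using not by (auto simp: n power2_eq_square)
  moreover have "m > 0" using assms n by (auto intro: Nat.gr0I)
  ultimately have "divisor_sum n = (1 + p) * divisor_sum m"
    using divisor_sum_prime_mult assms n by simp
  moreover have "odd p" using assms n by simp
  ultimately show False using assms by simp
qed

lemma prod_squares_le:
  fixes n :: nat
  assumes "n > 0" and sq: "\<And>p. prime p \<Longrightarrow> p dvd n \<Longrightarrow> p ^ 2 dvd n"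
  shows "(\<Prod>p\<in>prime_factors n. p ^ 2) \<le> n"
proof -
  \<comment> \<open>Compare with the prime factorization of \<open>n\<close> factor by
    factor.\<close>
  have "(\<Prod>p\<in>prime_factors n. p ^ 2) \<le> (\<Prod>p\<in>prime_factors n. p ^ multiplicity p n)"
  proof (rule prod_mono, safe)
    fix p assume p: "p \<in> prime_factors n"
    hence "2 \<le> multiplicity p n"
      using assms by (intro multiplicity_geI) (auto simp: prime_factors_dvd)
    thus "p ^ 2 \<le> p ^ multiplicity p n"
      using p by (intro power_increasing) (auto dest!: in_prime_factors_imp_prime prime_gt_0_nat)
  qed
  also have "\<dots> = n" using prime_factorization_nat assms by metis
  finally show ?thesis .
qed

theorem corollary1p6:
  fixes F :: nat
  assumes "friends F 10"
  shows "real F > 625 * 9 powi (int (omega F) - 3)"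
proof -
  from assms have pos: "F > 0" and ne: "F \<noteq> 10" and eq: "5 * divisor_sum F = 9 * F"
    by (auto simp: friends_10_iff)
  have "5 dvd F" using eq by presburger
  have "odd F"
  proof
    assume "even F"
    with \<open>5 dvd F\<close> have "10 dvd F" by presburger
    then obtain m where m: "F = 10 * m" by (auto elim: dvdE)
    hence "m > 1" using pos ne by (cases "m = 1") auto
    thus False using divisor_sum_multiple_10[of m] eq m by simp
  qed
  hence "odd (divisor_sum F)" using eq by presburger
  hence bound: "(\<Prod>p\<in>prime_factors F. p ^ 2) \<le> F"
    using pos \<open>odd F\<close> by (intro prod_squares_le square_dvd_of_odd_divisor_sum)
  have five: "5 \<in> prime_factors F"
    using \<open>5 dvd F\<close> pos by (simp add: prime_factors_dvd)
  have "3 ^ 2 \<le> p ^ 2" if "p \<in> prime_factors F - {5}" for p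
  proof -
    have "p \<ge> 2" using that by (auto dest: in_prime_factors_imp_prime prime_ge_2_nat)
    moreover have "p \<noteq> 2" using that \<open>odd F\<close> by auto
    ultimately have "p \<ge> 3" by simp
    thus ?thesis by (intro power_mono) auto
  qed
  hence "9 ^ card (prime_factors F - {5}) \<le> (\<Prod>p\<in>prime_factors F - {5}. p ^ 2)"
    unfolding prod_constant[symmetric] by (intro prod_mono) auto
  moreover have card: "omega F = Suc (card (prime_factors F - {5}))"
    using five unfolding omega_def by (intro card.remove) auto
  moreover have "(\<Prod>p\<in>prime_factors F. p ^ 2) = 25 * (\<Prod>p\<in>prime_factors F - {5}. p ^ 2)"
    using five by (subst prod.remove) auto
  ultimately have "25 * 9 ^ (omega F - 1) \<le> F"
    using bound by simp
  hence "25 * 9 ^ (omega F - 1) \<le> real F"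
    using of_nat_mono by fastforce
  \<comment> \<open>The integer exponent may be negative. By \<open>card\<close>,
    \<open>omega F\<close> is positive, so \<open>omega F - 1\<close> does not truncate.\<close>
  moreover have "(9::real) powi (int (omega F) - 3) = 9 ^ (omega F - 1) / 81"
    by (simp add: card power_int_diff power_int_add)
  \<comment> \<open>Writing \<open>x\<close> for this power, the bound reads
    \<open>F \<ge> 2025 * x\<close>; positivity of \<open>x\<close> makes this exceed
    \<open>625 * x\<close>.\<close>
  moreover have "(0::real) < 9 powi (int (omega F) - 3)" by simp
  ultimately show ?thesis by linarith
qed

end
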